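(* Let $t_0\in\mathbb{R}$ and let $r>0$ be finite and fixed. Let $A(t)=\sum_{n=0}^\infty A_n(t-t_0)^n$ and $B(t)=\sum_{n=0}^\infty B_n(t-t_0)^n$ be two random power series in the $\mathrm{L}^\infty(\Omega)$ setting, for $t\in(t_0-r,t_0+r)$, and let $Y_0,Y_1\in\mathrm{L}^2(\Omega)$. Suppose that $Y_0$ is absolutely continuous with density function $f_{Y_0}$ and is independent of $(Y_1,A_0,A_1,\ldots,B_0,B_1,\ldots)$. If $f_{Y_0}$ is Lipschitz continuous on $\mathbb{R}$, then for each $t\in(t_0-\delta,t_0+\delta)$ there is a constant $C_t>0$ (depending on $t$, but not on $x$ or $N$) such that for all $x\in\mathbb{R}$ and all $N\ge N_t$, $$|f_{X^N(t)}(x)-f_{X(t)}(x)|\le C_t\left((|x|+1)\|S_0^N(t)-S_0(t)\|_\infty+\|Y_1\|_2\|S_1^N(t)-S_1(t)\|_\infty\right),$$ and consequently $f_{X^N(t)}(x)$ converges to $f_{X(t)}(x)$ exponentially with $N$ for each $t\in(t_0-\delta,t_0+\delta)$ and $x\in\mathbb{R}$; that is, there exist $K>0$ and $q\in(0,1)$ (possibly depending on $t$ and $x$) with $|f_{X^N(t)}(x)-f_{X(t)}(x)|\le Kq^N$ for all $N\ge N_t$.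
   Context: $(\Omega,\mathcal{F},\mathbb{P})$ is a complete probability space; $\mathrm{L}^p(\Omega)$ is the Lebesgue space of real random variables with norm $\|\cdot\|_p$. A random power series $\sum_n A_n(t-t_0)^n$ is "in the $\mathrm{L}^\infty(\Omega)$ setting for $t\in(t_0-r,t_0+r)$" if $A_n\in\mathrm{L}^\infty(\Omega)$ for all $n$ and for every such $t$ the series converges in $\mathrm{L}^\infty(\Omega)$. $S_0(t)=\sum_{n\ge0}S_{0,n}(t-t_0)^n$ and $S_1(t)=\sum_{n\ge0}S_{1,n}(t-t_0)^n$ are the random power series, convergent in $\mathrm{L}^\infty(\Omega)$ for $t\in(t_0-r,t_0+r)$, with $S_{0,0}=1$, $S_{0,1}=0$, $S_{1,0}=0$, $S_{1,1}=1$ and, for $i\in\{0,1\}$ and $n\ge0$, $S_{i,n+2}=\frac{-1}{(n+2)(n+1)}\sum_{m=0}^n[(m+1)A_{n-m}S_{i,m+1}+B_{n-m}S_{i,m}]$. The process $X(t)=Y_0S_0(t)+Y_1S_1(t)$ is the mean square solution of $\ddot X+A\dot X+BX=0$, $X(t_0)=Y_0$, $\dot X(t_0)=Y_1$. $S_i^N(t)=\sum_{n=0}^NS_{i,n}(t-t_0)^n$ are the partial sums, and $X^N(t)=Y_0S_0^N(t)+Y_1S_1^N(t)$. $\delta\in(0,r]$ is a number such that $\|S_0(t)-1\|_\infty<1/4$ for all $t\in(t_0-\delta,t_0+\delta)$ (it exists since $S_0(t_0)=1$ and $S_0$ is continuous in $\mathrm{L}^\infty(\Omega)$); hence $S_0(t)>3/4$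 almost surely there. For $t\in(t_0-\delta,t_0+\delta)$, $N_t$ is a positive integer such that $\|S_0^N(t)-S_0(t)\|_\infty<1/4$ for all $N\ge N_t$, so that $S_0^N(t)>1/2$ almost surely for $N\ge N_t$. The densities of $X(t)$ and of $X^N(t)$ ($N\ge N_t$) are the functions $$f_{X(t)}(x)=\mathbb{E}\left[f_{Y_0}\left(\tfrac{x-Y_1S_1(t)}{S_0(t)}\right)\tfrac{1}{|S_0(t)|}\right],\qquad f_{X^N(t)}(x)=\mathbb{E}\left[f_{Y_0}\left(\tfrac{x-Y_1S_1^N(t)}{S_0^N(t)}\right)\tfrac{1}{|S_0^N(t)|}\right].$$ *)

theory Defs
  imports "HOL-Probability.Probability"
begin

definition rv_L2 :: "'a measure \<Rightarrow> ('a \<Rightarrow> real) \<Rightarrow> bool" where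
  "rv_L2 M X \<longleftrightarrow> X \<in> borel_measurable M \<and> integrable M (\<lambda>\<omega>. (X \<omega>)\<^sup>2)"

definition norm_L2 :: "'a measure \<Rightarrow> ('a \<Rightarrow> real) \<Rightarrow> real" where
  "norm_L2 M X = sqrt (\<integral>\<omega>. (X \<omega>)\<^sup>2 \<partial>M)"

definition rv_Linf :: "'a measure \<Rightarrow> ('a \<Rightarrow> real) \<Rightarrow> bool" where
  "rv_Linf M X \<longleftrightarrow> X \<in> borel_measurable M \<and> esssup M (\<lambda>\<omega>. ereal \<bar>X \<omega>\<bar>) < \<infinity>"

text \<open>Generalizes \<^const>\<open>prob_space.indep_var\<close>, which forces both variables to have the same
  value type; cf. \<open>prob_space.indep_var_eq\<close>.\<close>

definition indep_rv ::
  "'a measure \<Rightarrow> 'b measure \<Rightarrow> ('a \<Rightarrow> 'b) \<Rightarrow> 'c measure \<Rightarrow> ('a \<Rightarrow> 'c) \<Rightarrow> bool" where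
  "indep_rv M N1 X N2 Y \<longleftrightarrow> X \<in> measurable M N1 \<and> Y \<in> measurable M N2 \<and>
     prob_space.indep_set M
       (sets (vimage_algebra (space M) X N1)) (sets (vimage_algebra (space M) Y N2))"

text \<open>As \<^const>\<open>real_of_ereal\<close> maps \<open>\<infinity>\<close> to \<open>0\<close>, this is the norm only on \<^const>\<open>rv_Linf\<close>.\<close>

definition norm_Linf :: "'a measure \<Rightarrow> ('a \<Rightarrow> real) \<Rightarrow> real" where
  "norm_Linf M X = real_of_ereal (esssup M (\<lambda>\<omega>. ereal \<bar>X \<omega>\<bar>))"

definition Linf_sums :: "'a measure \<Rightarrow> (nat \<Rightarrow> 'a \<Rightarrow> real) \<Rightarrow> ('a \<Rightarrow> real) \<Rightarrow> bool" where
  "Linf_sums M F X \<longleftrightarrow> (\<forall>n. rv_Linf M (F n)) \<and> rv_Linf M X \<and>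
     (\<lambda>N. norm_Linf M (\<lambda>\<omega>. (\<Sum>n\<le>N. F n \<omega>) - X \<omega>)) \<longlonglongrightarrow> 0"

text \<open>Random variables are functions here, not classes modulo almost sure equality, so an
  \<open>L\<^sup>\<infinity>\<close>-limit is unique only almost surely; one version is chosen.\<close>

definition Linf_suminf :: "'a measure \<Rightarrow> (nat \<Rightarrow> 'a \<Rightarrow> real) \<Rightarrow> 'a \<Rightarrow> real" where
  "Linf_suminf M F = (SOME X. Linf_sums M F X)"

definition Linf_power_series ::
  "'a measure \<Rightarrow> (nat \<Rightarrow> 'a \<Rightarrow> real) \<Rightarrow> real \<Rightarrow> real \<Rightarrow> bool" where
  "Linf_power_series M A t0 r \<longleftrightarrow> (\<forall>n. rv_Linf M (A n)) \<and>
     (\<forall>t\<in>{t0-r<..<t0+r}. \<exists>X. Linf_sums M (\<lambda>n \<omega>. A n \<omega> * (t - t0) ^ n) X)"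

text \<open>Power series coefficients of the fundamental solutions of \<open>X'' + A X' + B X = 0\<close>;
  only \<open>i \<in> {0, 1}\<close> is used, and the solution is \<open>X = Y0 S\<^sub>0 + Y1 S\<^sub>1\<close>.\<close>

fun S_coeff ::
  "(nat \<Rightarrow> 'a \<Rightarrow> real) \<Rightarrow> (nat \<Rightarrow> 'a \<Rightarrow> real) \<Rightarrow> nat \<Rightarrow> nat \<Rightarrow> 'a \<Rightarrow> real" where
  "S_coeff A B i 0 \<omega> = (if i = 0 then 1 else 0)"
| "S_coeff A B i (Suc 0) \<omega> = (if i = 1 then 1 else 0)"
| "S_coeff A B i (Suc (Suc n)) \<omega> =
     - 1 / (real (n + 2) * real (n + 1)) *
     (\<Sum>m = 0..n. real (m + 1) * A (n - m) \<omega> * S_coeff A B i (Suc m) \<omega>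
                  + B (n - m) \<omega> * S_coeff A B i m \<omega>)"

definition S_series ::
  "'a measure \<Rightarrow> (nat \<Rightarrow> 'a \<Rightarrow> real) \<Rightarrow> (nat \<Rightarrow> 'a \<Rightarrow> real) \<Rightarrow> real \<Rightarrow> nat \<Rightarrow> real \<Rightarrow> 'a \<Rightarrow> real" where
  "S_series M A B t0 i t = Linf_suminf M (\<lambda>n \<omega>. S_coeff A B i n \<omega> * (t - t0) ^ n)"

definition S_partial ::
  "(nat \<Rightarrow> 'a \<Rightarrow> real) \<Rightarrow> (nat \<Rightarrow> 'a \<Rightarrow> real) \<Rightarrow> real \<Rightarrow> nat \<Rightarrow> nat \<Rightarrow> real \<Rightarrow> 'a \<Rightarrow> real" where
  "S_partial A B t0 i N t \<omega> = (\<Sum>n\<le>N. S_coeff A B i n \<omega> * (t - t0) ^ n)"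

text \<open>Density at \<open>x\<close> of \<open>Y0 U + Y1 V\<close>, where \<open>Y0\<close> has density \<open>f\<close>, is independent of
  \<open>(Y1, U, V)\<close>, and \<open>U\<close> is almost surely nonzero.\<close>

definition dens_comb ::
  "'a measure \<Rightarrow> (real \<Rightarrow> real) \<Rightarrow> ('a \<Rightarrow> real) \<Rightarrow> ('a \<Rightarrow> real) \<Rightarrow> ('a \<Rightarrow> real) \<Rightarrow> real \<Rightarrow> real" where
  "dens_comb M f Y1 U V x = (\<integral>\<omega>. f ((x - Y1 \<omega> * V \<omega>) / U \<omega>) * (1 / \<bar>U \<omega>\<bar>) \<partial>M)"

definition dens_X where
  "dens_X M f Y1 A B t0 t = dens_comb M f Y1 (S_series M A B t0 0 t) (S_series M A B t0 1 t)"

definition dens_XN where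
  "dens_XN M f Y1 A B t0 N t = dens_comb M f Y1 (S_partial A B t0 0 N t) (S_partial A B t0 1 N t)"

end

theory Submission
  imports Defs
begin

text \<open>
  The approximate density and the density are integrals of the same expression
  \<open>f ((x - y v) / u) / \<bar>u\<bar>\<close>, taken at \<open>(S\<^sub>0\<^sup>N, S\<^sub>1\<^sup>N)\<close> and at \<open>(S\<^sub>0, S\<^sub>1)\<close>. Where \<open>u\<close> stays
  away from \<open>0\<close>, a Lipschitz \<open>f\<close> makes this expression Lipschitz in \<open>(u, v)\<close>, with a
  constant that grows only linearly in \<open>\<bar>x\<bar>\<close> and \<open>\<bar>y\<bar>\<close> (\<open>dens_integrand_diff\<close>): moving
  \<open>u\<close> moves the argument of \<open>f\<close> by a multiple of \<open>x - y v\<close>, and \<open>f\<close> itself grows at most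
  linearly. The two smallness hypotheses give \<open>S\<^sub>0 > 3/4\<close> and \<open>S\<^sub>0\<^sup>N > 1/2\<close> almost surely. Since
  \<open>E \<bar>Y\<^sub>1\<bar> \<le> \<parallel>Y\<^sub>1\<parallel>\<^sub>2\<close>, taking expectations gives the first estimate (\<open>dens_comb_diff\<close>).

  The exponential rate comes from the power series. Convergence of the series of \<open>A\<close> and \<open>B\<close>
  at distance \<open>\<rho> < r\<close> from \<open>t\<^sub>0\<close> bounds \<open>\<bar>A\<^sub>n\<bar> \<rho>\<^sup>n\<close> and \<open>\<bar>B\<^sub>n\<bar> \<rho>\<^sup>n\<close> almost surely by one constant.
  The recursion then bounds \<open>\<bar>S\<^sub>i\<^sub>,\<^sub>n\<bar> s\<^sup>n\<close> for every \<open>s < \<rho>\<close> (\<open>S_coeff_geometric_bound\<close>). Choosing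
  \<open>\<bar>t - t\<^sub>0\<bar> < s\<close> dominates the terms of \<open>S\<^sub>i(t)\<close> by a geometric series, whose tails bound
  the two errors in the first estimate.
\<close>

section \<open>Essentially bounded random variables\<close>

text \<open>The total mass must be positive: the essential supremum over a null space is
  \<open>-\<infinity>\<close>.\<close>

lemma esssup_abs_nonneg:
  fixes X :: "'a \<Rightarrow> real"
  assumes "prob_space M"
  shows "0 \<le> esssup M (\<lambda>\<omega>. ereal \<bar>X \<omega>\<bar>)"
proof (cases "(\<lambda>\<omega>. ereal \<bar>X \<omega>\<bar>) \<in> borel_measurable M")
  case True
  interpret prob_space M by fact
  have "esssup M (\<lambda>\<omega>. 0 :: ereal) \<le> esssup M (\<lambda>\<omega>. ereal \<bar>X \<omega>\<bar>)"
    by (rule esssup_mono) auto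
  moreover have "esssup M (\<lambda>\<omega>. 0 :: ereal) = 0"
    by (rule esssup_const) (simp add: emeasure_space_1)
  ultimately show ?thesis by simp
qed (simp add: esssup_non_measurable)

lemma AE_abs_le_norm_Linf:
  assumes "prob_space M" and "rv_Linf M X"
  shows "AE \<omega> in M. \<bar>X \<omega>\<bar> \<le> norm_Linf M X"
proof -
  have X[measurable]: "X \<in> borel_measurable M"
    and fin: "esssup M (\<lambda>\<omega>. ereal \<bar>X \<omega>\<bar>) < \<infinity>"
    using assms(2) by (auto simp: rv_Linf_def)
  have "esssup M (\<lambda>\<omega>. ereal \<bar>X \<omega>\<bar>) = ereal (norm_Linf M X)"
    using fin esssup_abs_nonneg[OF assms(1), of X] unfolding norm_Linf_def
    by (cases "esssup M (\<lambda>\<omega>. ereal \<bar>X \<omega>\<bar>)") auto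
  then show ?thesis
    using esssup_AE[of "\<lambda>\<omega>. ereal \<bar>X \<omega>\<bar>" M] by simp
qed

lemma rv_Linf_norm_Linf_le:
  assumes "prob_space M" and X[measurable]: "X \<in> borel_measurable M"
    and bd: "AE \<omega> in M. \<bar>X \<omega>\<bar> \<le> c"
  shows "rv_Linf M X" and "norm_Linf M X \<le> c"
proof -
  have le: "esssup M (\<lambda>\<omega>. ereal \<bar>X \<omega>\<bar>) \<le> ereal c"
    by (rule esssup_I) (use bd in auto)
  note ge = esssup_abs_nonneg[OF assms(1), of X]
  show "rv_Linf M X" using le X
    unfolding rv_Linf_def by (auto intro: le_less_trans)
  show "norm_Linf M X \<le> c" using le ge unfolding norm_Linf_def
    by (cases "esssup M (\<lambda>\<omega>. ereal \<bar>X \<omega>\<bar>)") auto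
qed

lemma norm_Linf_nonneg:
  assumes "prob_space M" and "rv_Linf M X"
  shows "0 \<le> norm_Linf M X"
proof -
  interpret prob_space M by fact
  have "AE \<omega> in M. 0 \<le> norm_Linf M X"
    using AE_abs_le_norm_Linf[OF assms] by eventually_elim linarith
  then show ?thesis by simp
qed

lemma rv_Linf_diff:
  assumes "prob_space M" and "rv_Linf M X" and "rv_Linf M Y"
  shows "rv_Linf M (\<lambda>\<omega>. X \<omega> - Y \<omega>)"
proof (rule rv_Linf_norm_Linf_le(1))
  show "AE \<omega> in M. \<bar>X \<omega> - Y \<omega>\<bar> \<le> norm_Linf M X + norm_Linf M Y"
    using AE_abs_le_norm_Linf[OF assms(1,2)] AE_abs_le_norm_Linf[OF assms(1,3)]
    by eventually_elim linarith
qed (use assms in \<open>auto simp: rv_Linf_def\<close>)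

lemma rv_Linf_sum:
  fixes F :: "nat \<Rightarrow> 'a \<Rightarrow> real"
  assumes "prob_space M" and "\<And>n. rv_Linf M (F n)"
  shows "rv_Linf M (\<lambda>\<omega>. \<Sum>n\<le>N. F n \<omega>)"
proof (rule rv_Linf_norm_Linf_le(1))
  have "AE \<omega> in M. \<forall>n. \<bar>F n \<omega>\<bar> \<le> norm_Linf M (F n)"
    unfolding AE_all_countable by (intro allI AE_abs_le_norm_Linf assms)
  then show "AE \<omega> in M. \<bar>\<Sum>n\<le>N. F n \<omega>\<bar> \<le> (\<Sum>n\<le>N. norm_Linf M (F n))"
    by eventually_elim (auto intro: order_trans[OF sum_abs] sum_mono)
qed (use assms in \<open>auto simp: rv_Linf_def intro!: borel_measurable_sum\<close>)

section \<open>Series in the space of essentially bounded random variables\<close>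

lemma Linf_sums_AE_partial:
  assumes "prob_space M" and S: "Linf_sums M F X"
  shows "AE \<omega> in M. \<forall>N. \<bar>(\<Sum>n\<le>N. F n \<omega>) - X \<omega>\<bar>
                       \<le> norm_Linf M (\<lambda>\<omega>. (\<Sum>n\<le>N. F n \<omega>) - X \<omega>)"
  unfolding AE_all_countable
  by (intro allI AE_abs_le_norm_Linf rv_Linf_diff rv_Linf_sum)
    (use assms in \<open>auto simp: Linf_sums_def\<close>)

text \<open>Only countably many null sets are discarded, one for each partial sum. Pointwise sums
  determine the limit almost surely, so estimates for the pointwise sum hold for any version.\<close>

lemma Linf_sums_AE_sums:
  assumes "prob_space M" and S: "Linf_sums M F X"
  shows "AE \<omega> in M. (\<lambda>n. F n \<omega>) sums X \<omega>"
  using Linf_sums_AE_partial[OF assms]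
proof eventually_elim
  case (elim \<omega>)
  have "(\<lambda>N. norm_Linf M (\<lambda>\<omega>. (\<Sum>n\<le>N. F n \<omega>) - X \<omega>)) \<longlonglongrightarrow> 0"
    using S by (simp add: Linf_sums_def)
  then have "(\<lambda>N. (\<Sum>n\<le>N. F n \<omega>) - X \<omega>) \<longlonglongrightarrow> 0"
    by (rule Lim_null_comparison[rotated]) (use elim in auto)
  then show ?case
    by (simp add: sums_def_le LIM_zero_iff)
qed

text \<open>Each term is a difference of two partial sums, and these are uniformly bounded because
  their distances to the limit are.\<close>

lemma Linf_sums_AE_bounded_terms:
  assumes "prob_space M" and S: "Linf_sums M F X"
  shows "\<exists>C. AE \<omega> in M. \<forall>n. \<bar>F n \<omega>\<bar> \<le> C"
proof -
  let ?e = "\<lambda>N. norm_Linf M (\<lambda>\<omega>. (\<Sum>n\<le>N. F n \<omega>) - X \<omega>)"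
  have "?e \<longlonglongrightarrow> 0" and X: "rv_Linf M X"
    using S by (simp_all add: Linf_sums_def)
  then have "Bseq ?e" by (intro convergent_imp_Bseq) (auto simp: convergent_def)
  then obtain K where "\<And>N. \<bar>?e N\<bar> \<le> K" unfolding Bseq_def by auto
  then have K: "?e N \<le> K" for N by (meson abs_le_D1)
  have "AE \<omega> in M. \<forall>n. \<bar>F n \<omega>\<bar> \<le> 2 * (K + norm_Linf M X)"
    using Linf_sums_AE_partial[OF assms] AE_abs_le_norm_Linf[OF assms(1) X]
  proof eventually_elim
    case (elim \<omega>)
    have P: "\<bar>\<Sum>n\<le>N. F n \<omega>\<bar> \<le> K + norm_Linf M X" for N
      using elim(1)[rule_format, of N] elim(2) K[of N] by linarith
    show ?case
    proof
      fix n
      show "\<bar>F n \<omega>\<bar> \<le> 2 * (K + norm_Linf M X)"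
      proof (cases n)
        case 0
        then show ?thesis using P[of 0] by simp
      next
        case (Suc k)
        then show ?thesis using P[of k] P[of "Suc k"] by simp
      qed
    qed
  qed
  then show ?thesis by blast
qed

lemma geometric_tail_bound:
  fixes a :: "nat \<Rightarrow> real"
  assumes "a sums x" and a: "\<And>n. \<bar>a n\<bar> \<le> D * q ^ n" and q: "0 \<le> q" "q < 1"
  shows "\<bar>(\<Sum>n\<le>N. a n) - x\<bar> \<le> D * q ^ Suc N / (1 - q)"
proof -
  have "(\<lambda>n. a (n + Suc N)) sums (x - (\<Sum>n<Suc N. a n))"
    using assms(1) by (simp only: sums_iff_shift[of a "Suc N"] diff_add_cancel)
  then have "x - (\<Sum>n\<le>N. a n) = (\<Sum>n. a (n + Suc N))"
    by (simp add: sums_iff lessThan_Suc_atMost)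
  moreover have "norm (\<Sum>n. a (n + Suc N)) \<le> (\<Sum>n. D * q ^ Suc N * q ^ n)"
  proof (rule norm_suminf_le)
    show "norm (a (n + Suc N)) \<le> D * q ^ Suc N * q ^ n" for n
      using a[of "n + Suc N"] by (simp add: power_add mult_ac)
    show "summable (\<lambda>n. D * q ^ Suc N * q ^ n)"
      using q by (intro summable_mult summable_geometric) auto
  qed
  moreover have "(\<Sum>n. D * q ^ Suc N * q ^ n) = D * q ^ Suc N / (1 - q)"
    using q by (subst suminf_mult) (auto simp: suminf_geometric intro!: summable_geometric)
  ultimately show ?thesis by (simp add: abs_minus_commute)
qed

lemma norm_Linf_geometric_tail:
  assumes "prob_space M" and F[measurable]: "\<And>n. F n \<in> borel_measurable M"
    and X[measurable]: "X \<in> borel_measurable M"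
    and sums: "AE \<omega> in M. (\<lambda>n. F n \<omega>) sums X \<omega>"
    and bd: "AE \<omega> in M. \<forall>n. \<bar>F n \<omega>\<bar> \<le> D * q ^ n" and q: "0 \<le> q" "q < 1"
  shows "norm_Linf M (\<lambda>\<omega>. (\<Sum>n\<le>N. F n \<omega>) - X \<omega>) \<le> D * q ^ Suc N / (1 - q)"
proof (rule rv_Linf_norm_Linf_le(2)[OF assms(1)])
  show "AE \<omega> in M. \<bar>(\<Sum>n\<le>N. F n \<omega>) - X \<omega>\<bar> \<le> D * q ^ Suc N / (1 - q)"
    using sums bd by eventually_elim (rule geometric_tail_bound[OF _ _ q], auto)
qed simp

lemma Linf_sums_geometric:
  assumes "prob_space M" and F[measurable]: "\<And>n. F n \<in> borel_measurable M"
    and bd: "AE \<omega> in M. \<forall>n. \<bar>F n \<omega>\<bar> \<le> D * q ^ n" and q: "0 \<le> q" "q < 1"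
  shows "Linf_sums M F (\<lambda>\<omega>. \<Sum>n. F n \<omega>)"
proof -
  let ?X = "\<lambda>\<omega>. \<Sum>n. F n \<omega>"
  have F_Linf: "rv_Linf M (F n)" for n
    by (rule rv_Linf_norm_Linf_le(1)[OF assms(1) F, of n "D * q ^ n"])
      (use bd in \<open>auto elim!: eventually_mono\<close>)
  have sums: "AE \<omega> in M. (\<lambda>n. F n \<omega>) sums ?X \<omega>"
    using bd
  proof eventually_elim
    case (elim \<omega>)
    have "summable (\<lambda>n. D * q ^ n)"
      using q by (intro summable_mult summable_geometric) auto
    then have "summable (\<lambda>n. F n \<omega>)"
      by (rule summable_comparison_test'[where N = 0]) (use elim in auto)
    then show ?case by (rule summable_sums)
  qed
  have tail: "AE \<omega> in M. \<bar>(\<Sum>n\<le>N. F n \<omega>) - ?X \<omega>\<bar> \<le> D * q ^ Suc N / (1 - q)" for N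
    using sums bd by eventually_elim (rule geometric_tail_bound[OF _ _ q], auto)
  have diff: "rv_Linf M (\<lambda>\<omega>. (\<Sum>n\<le>N. F n \<omega>) - ?X \<omega>)" for N
    by (rule rv_Linf_norm_Linf_le(1)[OF assms(1) _ tail]) simp
  \<comment> \<open>The limit is a partial sum minus its error, both of which are essentially bounded.\<close>
  have "rv_Linf M (\<lambda>\<omega>. (\<Sum>n\<le>0. F n \<omega>) - ((\<Sum>n\<le>0. F n \<omega>) - ?X \<omega>))"
    by (rule rv_Linf_diff[OF assms(1) rv_Linf_sum[OF assms(1) F_Linf] diff])
  then have "rv_Linf M ?X" by simp
  moreover have "(\<lambda>N. norm_Linf M (\<lambda>\<omega>. (\<Sum>n\<le>N. F n \<omega>) - ?X \<omega>)) \<longlonglongrightarrow> 0"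
  proof (rule tendsto_sandwich)
    show "\<forall>\<^sub>F N in sequentially. 0 \<le> norm_Linf M (\<lambda>\<omega>. (\<Sum>n\<le>N. F n \<omega>) - ?X \<omega>)"
      using norm_Linf_nonneg[OF assms(1) diff] by simp
    show "\<forall>\<^sub>F N in sequentially. norm_Linf M (\<lambda>\<omega>. (\<Sum>n\<le>N. F n \<omega>) - ?X \<omega>)
            \<le> D * q ^ Suc N / (1 - q)"
      using norm_Linf_geometric_tail[OF assms(1) F _ sums bd q] by simp
    have "(\<lambda>N. q ^ Suc N) \<longlonglongrightarrow> 0"
      using q by (intro LIMSEQ_Suc LIMSEQ_power_zero) simp
    then show "(\<lambda>N. D * q ^ Suc N / (1 - q)) \<longlonglongrightarrow> 0"
      using tendsto_mult_right[of "\<lambda>N. q ^ Suc N" 0 sequentially "D / (1 - q)"]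
      by (simp add: mult_ac)
  qed simp
  ultimately show ?thesis
    using F_Linf by (simp add: Linf_sums_def)
qed

section \<open>Growth of the coefficients of the fundamental solutions\<close>

text \<open>Put \<open>T n = \<bar>S n\<bar> s\<^sup>n\<close> and \<open>z = s / \<rho>\<close>. If \<open>T\<close> is at most \<open>W\<close> up to index \<open>n + 1\<close>, the
  recursion gives
  \<open>T (n + 2) \<le> 1 / ((n + 2) (n + 1)) \<cdot> \<Sum>m\<le>n. (n + 1) C z\<^sup>n\<^sup>-\<^sup>m (s + s\<^sup>2) W \<le> K / (n + 2) \<cdot> W\<close>.
  So the running maximum can grow, by a factor of at most \<open>1 + K\<close>, only while the index is
  at most \<open>K\<close>, and is constant afterwards. The truncated exponent \<open>min n n0\<close> records
  both phases in one induction. The bound depends on \<open>\<omega>\<close> only through \<open>C\<close>, hence is uniform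
  off a null set.\<close>

lemma S_coeff_geometric_bound:
  fixes \<omega> :: 'a
  assumes s: "0 < s" "s < \<rho>"
    and A: "\<And>n. \<bar>A n \<omega>\<bar> * \<rho> ^ n \<le> C" and B: "\<And>n. \<bar>B n \<omega>\<bar> * \<rho> ^ n \<le> C"
    and K: "K = C * (s + s\<^sup>2) / (1 - s / \<rho>)" and n0: "K \<le> real n0"
  shows "\<bar>S_coeff A B i n \<omega>\<bar> * s ^ n \<le> (1 + s) * (1 + K) ^ min n n0"
proof -
  define z where "z = s / \<rho>"
  define W where "W n = (1 + s) * (1 + K) ^ min n n0" for n
  have z: "0 < z" "z < 1" using s by (auto simp: z_def)
  have "0 \<le> \<bar>A 0 \<omega>\<bar> * \<rho> ^ 0" by simp
  also have "\<dots> \<le> C" by (rule A)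
  finally have C: "0 \<le> C" .
  have K0: "0 \<le> K" using C s z by (simp add: K z_def[symmetric])
  have W_mono: "W m \<le> W n" if "m \<le> n" for m n
    unfolding W_def using that K0 s by (intro mult_left_mono power_increasing) auto
  have W_pos: "0 < W n" for n using K0 s by (simp add: W_def)
  have scaled: "\<bar>a\<bar> * s ^ k \<le> C * z ^ k" if "\<bar>a\<bar> * \<rho> ^ k \<le> C" for a k
  proof -
    have "\<bar>a\<bar> * s ^ k = (\<bar>a\<bar> * \<rho> ^ k) * z ^ k" using s by (simp add: z_def power_divide)
    also have "\<dots> \<le> C * z ^ k" using that z by (intro mult_right_mono) auto
    finally show ?thesis .
  qed
  have "\<bar>S_coeff A B i n \<omega>\<bar> * s ^ n \<le> W n"
  proof (induction n rule: less_induct)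
    case (less k)
    consider "k = 0" | "k = 1" | n where "k = Suc (Suc n)"
      by (metis One_nat_def not0_implies_Suc)
    then show ?case
    proof cases
      case 1
      then show ?thesis using s by (simp add: W_def)
    next
      case 2
      have "\<bar>S_coeff A B i 1 \<omega>\<bar> * s ^ 1 \<le> 1 + s" using s by simp
      also have "\<dots> = W 0" by (simp add: W_def)
      also have "\<dots> \<le> W 1" by (rule W_mono) simp
      finally show ?thesis using 2 by simp
    next
      case (3 n)
      let ?S = "\<lambda>m. S_coeff A B i m \<omega>"
      have IH: "\<bar>?S m\<bar> * s ^ m \<le> W (Suc n)" if "m \<le> Suc n" for m
        using less.IH[of m] W_mono[OF that] that 3 by simp
      have summand: "\<bar>real (m + 1) * A (n - m) \<omega> * ?S (Suc m) + B (n - m) \<omega> * ?S m\<bar> * s ^ k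
            \<le> real (n + 1) * (C * W (Suc n) * (s + s\<^sup>2)) * z ^ (n - m)"
        if m: "m \<le> n" for m
      proof -
        have sk: "s ^ k = s ^ (n - m) * s ^ m * s\<^sup>2"
          using m 3 by (simp flip: power_add)
        have a: "\<bar>A (n - m) \<omega>\<bar> * s ^ (n - m) * (\<bar>?S (Suc m)\<bar> * s ^ Suc m)
              \<le> C * z ^ (n - m) * W (Suc n)"
          using C s z m by (intro mult_mono scaled A IH) auto
        have "\<bar>A (n - m) \<omega>\<bar> * s ^ (n - m) * (\<bar>?S (Suc m)\<bar> * s ^ Suc m) * (real (m + 1) * s)
              \<le> C * z ^ (n - m) * W (Suc n) * (real (n + 1) * s)"
          by (rule mult_mono[OF a])
            (use C s z m less_imp_le[OF W_pos[of "Suc n"]] in \<open>auto intro: mult_right_mono\<close>)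
        then have 1: "\<bar>real (m + 1) * A (n - m) \<omega> * ?S (Suc m)\<bar> * s ^ k
              \<le> real (n + 1) * (C * W (Suc n) * s) * z ^ (n - m)"
          by (simp add: sk abs_mult power2_eq_square mult_ac)
        have b: "\<bar>B (n - m) \<omega>\<bar> * s ^ (n - m) * (\<bar>?S m\<bar> * s ^ m) \<le> C * z ^ (n - m) * W (Suc n)"
          using C s z m by (intro mult_mono scaled B IH) auto
        have "\<bar>B (n - m) \<omega>\<bar> * s ^ (n - m) * (\<bar>?S m\<bar> * s ^ m) * (1 * s\<^sup>2)
              \<le> C * z ^ (n - m) * W (Suc n) * (real (n + 1) * s\<^sup>2)"
          by (rule mult_mono[OF b])
            (use C s z m less_imp_le[OF W_pos[of "Suc n"]] in \<open>auto simp: distrib_right\<close>)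
        then have 2: "\<bar>B (n - m) \<omega> * ?S m\<bar> * s ^ k
              \<le> real (n + 1) * (C * W (Suc n) * s\<^sup>2) * z ^ (n - m)"
          by (simp only: sk abs_mult mult_ac mult_1_right mult_1_left)
        have "\<bar>real (m + 1) * A (n - m) \<omega> * ?S (Suc m) + B (n - m) \<omega> * ?S m\<bar> * s ^ k
            \<le> (\<bar>real (m + 1) * A (n - m) \<omega> * ?S (Suc m)\<bar> + \<bar>B (n - m) \<omega> * ?S m\<bar>) * s ^ k"
          using s by (intro mult_right_mono abs_triangle_ineq) auto
        also have "\<dots> \<le> real (n + 1) * (C * W (Suc n) * s) * z ^ (n - m)
              + real (n + 1) * (C * W (Suc n) * s\<^sup>2) * z ^ (n - m)"
          unfolding distrib_right[of _ _ "s ^ k"] by (rule add_mono[OF 1 2])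
        finally show ?thesis by (simp only: distrib_left distrib_right)
      qed
      let ?T = "\<lambda>m. real (m + 1) * A (n - m) \<omega> * ?S (Suc m) + B (n - m) \<omega> * ?S m"
      have geo: "(\<Sum>m = 0..n. z ^ (n - m)) \<le> 1 / (1 - z)"
      proof -
        have "(\<Sum>m = 0..n. z ^ (n - m)) = (\<Sum>m = 0..n. z ^ m)"
          using sum.atLeastAtMost_rev[of "\<lambda>m. z ^ m" 0 n] by simp
        also have "\<dots> \<le> (\<Sum>m. z ^ m)"
          using z by (intro sum_le_suminf summable_geometric) auto
        also have "\<dots> = 1 / (1 - z)" using z by (intro suminf_geometric) auto
        finally show ?thesis .
      qed
      have "\<bar>\<Sum>m = 0..n. ?T m\<bar> * s ^ k \<le> (\<Sum>m = 0..n. \<bar>?T m\<bar>) * s ^ k"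
        using s by (intro mult_right_mono sum_abs) auto
      also have "\<dots> = (\<Sum>m = 0..n. \<bar>?T m\<bar> * s ^ k)" by (rule sum_distrib_right)
      also have "\<dots> \<le> (\<Sum>m = 0..n. real (n + 1) * (C * W (Suc n) * (s + s\<^sup>2)) * z ^ (n - m))"
        by (intro sum_mono summand) simp
      also have "\<dots> = real (n + 1) * (C * W (Suc n) * (s + s\<^sup>2)) * (\<Sum>m = 0..n. z ^ (n - m))"
        by (rule sum_distrib_left[symmetric])
      also have "\<dots> \<le> real (n + 1) * (C * W (Suc n) * (s + s\<^sup>2)) * (1 / (1 - z))"
        using C s W_pos[of "Suc n"] by (intro mult_left_mono geo) auto
      also have "\<dots> = real (n + 1) * (K * W (Suc n))"
        by (simp add: K z_def)
      finally have sum_le: "\<bar>\<Sum>m = 0..n. ?T m\<bar> * s ^ k \<le> real (n + 1) * (K * W (Suc n))" .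
      have "\<bar>?S k\<bar> * s ^ k = (\<bar>\<Sum>m = 0..n. ?T m\<bar> * s ^ k) / (real (n + 2) * real (n + 1))"
        unfolding 3 S_coeff.simps abs_mult by simp
      also have "\<dots> \<le> (real (n + 1) * (K * W (Suc n))) / (real (n + 2) * real (n + 1))"
        by (intro divide_right_mono sum_le) simp
      also have "\<dots> = K / real (n + 2) * W (Suc n)"
        by (simp add: field_simps del: of_nat_Suc of_nat_add)
      also have "\<dots> \<le> W k"
      proof (cases "k \<le> n0")
        case True
        have "K / real (n + 2) \<le> K" using K0 by (simp add: field_simps mult_left_mono)
        then have "K / real (n + 2) * W (Suc n) \<le> (1 + K) * W (Suc n)"
          using W_pos[of "Suc n"] by (intro mult_right_mono) auto
        also have "\<dots> = W k" using True 3 by (simp add: W_def min_absorb1)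
        finally show ?thesis .
      next
        case False
        then have "K / real (n + 2) \<le> 1" using n0 3 by (simp add: field_simps)
        then have "K / real (n + 2) * W (Suc n) \<le> 1 * W (Suc n)"
          using W_pos[of "Suc n"] by (intro mult_right_mono) auto
        also have "\<dots> \<le> W k" using W_mono[of "Suc n" k] 3 by simp
        finally show ?thesis .
      qed
      finally show ?thesis .
    qed
  qed
  then show ?thesis by (simp add: W_def)
qed

lemma S_coeff_measurable[measurable]:
  assumes [measurable]: "\<And>n. A n \<in> borel_measurable M" "\<And>n. B n \<in> borel_measurable M"
  shows "S_coeff A B i n \<in> borel_measurable M"
proof (induction n rule: less_induct)
  case (less k)
  consider "k = 0" | "k = 1" | n where "k = Suc (Suc n)"
    by (metis One_nat_def not0_implies_Suc)
  then show ?case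
  proof cases
    case (3 n)
    have [measurable]: "S_coeff A B i m \<in> borel_measurable M"
      "S_coeff A B i (Suc m) \<in> borel_measurable M" if "m \<in> {0..n}" for m
      using that 3 by (auto intro!: less.IH)
    show ?thesis unfolding 3 S_coeff.simps by measurable
  qed (simp_all)
qed

lemma Linf_power_series_coeff_bound:
  assumes "prob_space M" and "Linf_power_series M A t0 r" and "0 < \<rho>" "\<rho> < r"
  shows "\<exists>C. AE \<omega> in M. \<forall>n. \<bar>A n \<omega>\<bar> * \<rho> ^ n \<le> C"
proof -
  have "t0 + \<rho> \<in> {t0 - r<..<t0 + r}" using assms(3,4) by simp
  then obtain X where "Linf_sums M (\<lambda>n \<omega>. A n \<omega> * (t0 + \<rho> - t0) ^ n) X"
    using assms(2) unfolding Linf_power_series_def by blast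
  from Linf_sums_AE_bounded_terms[OF assms(1) this] show ?thesis
    using assms(3) by (simp add: abs_mult power_abs)
qed

text \<open>Three radii \<open>\<bar>t - t0\<bar> < d < s < \<rho>\<close> are used: the gap between \<open>s\<close> and \<open>\<rho>\<close> keeps the
  convolution in the recursion summable, and \<open>q = d / s\<close> is the ratio. Taking \<open>d\<close> instead of
  \<open>\<bar>t - t0\<bar>\<close> keeps \<open>q\<close> positive also for \<open>t = t0\<close>.\<close>

lemma S_coeff_AE_geometric:
  assumes "prob_space M" and PA: "Linf_power_series M A t0 r" and PB: "Linf_power_series M B t0 r"
    and t: "\<bar>t - t0\<bar> < r"
  obtains q D where "0 < q" "q < 1"
    "\<And>i. AE \<omega> in M. \<forall>n. \<bar>S_coeff A B i n \<omega> * (t - t0) ^ n\<bar> \<le> D * q ^ n"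
proof -
  obtain \<rho> where \<rho>: "\<bar>t - t0\<bar> < \<rho>" "\<rho> < r" using dense[OF t] by blast
  obtain s where s: "\<bar>t - t0\<bar> < s" "s < \<rho>" using dense[OF \<rho>(1)] by blast
  obtain d where d: "\<bar>t - t0\<bar> < d" "d < s" using dense[OF s(1)] by blast
  have \<rho>0: "0 < \<rho>" and s0: "0 < s" and d0: "0 < d" using \<rho> s d by linarith+
  obtain C1 where C1: "AE \<omega> in M. \<forall>n. \<bar>A n \<omega>\<bar> * \<rho> ^ n \<le> C1"
    using Linf_power_series_coeff_bound[OF assms(1) PA \<rho>0 \<rho>(2)] by blast
  obtain C2 where C2: "AE \<omega> in M. \<forall>n. \<bar>B n \<omega>\<bar> * \<rho> ^ n \<le> C2"
    using Linf_power_series_coeff_bound[OF assms(1) PB \<rho>0 \<rho>(2)] by blast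
  define C where "C = max 0 (max C1 C2)"
  define K where "K = C * (s + s\<^sup>2) / (1 - s / \<rho>)"
  define n0 where "n0 = nat \<lceil>K\<rceil>"
  define D where "D = (1 + s) * (1 + K) ^ n0"
  have K0: "0 \<le> K" using s0 s(2) \<rho>0 by (simp add: K_def C_def)
  have n0: "K \<le> real n0" unfolding n0_def by linarith
  have "AE \<omega> in M. \<forall>n. \<bar>S_coeff A B i n \<omega> * (t - t0) ^ n\<bar> \<le> D * (d / s) ^ n" for i
    using C1 C2
  proof eventually_elim
    case (elim \<omega>)
    show ?case
    proof
      fix n
      have "\<bar>S_coeff A B i n \<omega>\<bar> * s ^ n \<le> (1 + s) * (1 + K) ^ min n n0"
      proof (rule S_coeff_geometric_bound[OF s0 s(2) _ _ K_def n0])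
        show "\<bar>A n \<omega>\<bar> * \<rho> ^ n \<le> C" for n
          using elim(1)[rule_format, of n] by (simp add: C_def)
        show "\<bar>B n \<omega>\<bar> * \<rho> ^ n \<le> C" for n
          using elim(2)[rule_format, of n] by (simp add: C_def)
      qed
      also have "\<dots> \<le> D"
        unfolding D_def using K0 s0 by (intro mult_left_mono power_increasing) auto
      finally have SD: "\<bar>S_coeff A B i n \<omega>\<bar> * s ^ n \<le> D" .
      have "\<bar>S_coeff A B i n \<omega> * (t - t0) ^ n\<bar> \<le> \<bar>S_coeff A B i n \<omega>\<bar> * d ^ n"
        unfolding abs_mult power_abs using d by (intro mult_left_mono power_mono) auto
      also have "\<dots> = (\<bar>S_coeff A B i n \<omega>\<bar> * s ^ n) * (d / s) ^ n"
        using s0 by (simp add: power_divide)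
      also have "\<dots> \<le> D * (d / s) ^ n"
        using SD d0 s0 by (intro mult_right_mono) auto
      finally show "\<bar>S_coeff A B i n \<omega> * (t - t0) ^ n\<bar> \<le> D * (d / s) ^ n" .
    qed
  qed
  then show thesis
    using that[of "d / s" D] d d0 s0 by simp
qed

text \<open>The process chosen by \<^const>\<open>S_series\<close> is an arbitrary version of the limit; existence of
  some limit is what makes the choice meaningful, and the pointwise sum supplies it.\<close>

lemma S_series_Linf:
  assumes "prob_space M" and PA: "Linf_power_series M A t0 r" and PB: "Linf_power_series M B t0 r"
    and t: "\<bar>t - t0\<bar> < r"
  obtains q D where "0 < q" "q < 1"
    "\<And>i. Linf_sums M (\<lambda>n \<omega>. S_coeff A B i n \<omega> * (t - t0) ^ n) (S_series M A B t0 i t)"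
    "\<And>i N. norm_Linf M (\<lambda>\<omega>. S_partial A B t0 i N t \<omega> - S_series M A B t0 i t \<omega>) \<le> D * q ^ N"
proof -
  obtain q D where q: "0 < q" "q < 1"
    and bd: "\<And>i. AE \<omega> in M. \<forall>n. \<bar>S_coeff A B i n \<omega> * (t - t0) ^ n\<bar> \<le> D * q ^ n"
    by (rule S_coeff_AE_geometric[OF assms]) (rule that)
  let ?F = "\<lambda>i n \<omega>. S_coeff A B i n \<omega> * (t - t0) ^ n"
  have [measurable]: "A n \<in> borel_measurable M" "B n \<in> borel_measurable M" for n
    using PA PB by (auto simp: Linf_power_series_def rv_Linf_def)
  have F: "?F i n \<in> borel_measurable M" for i n by measurable
  have sums: "Linf_sums M (?F i) (S_series M A B t0 i t)" for i
    unfolding S_series_def Linf_suminf_def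
    by (rule someI[of "Linf_sums M (?F i)", OF Linf_sums_geometric[OF assms(1) F bd]])
      (use q in auto)
  have "norm_Linf M (\<lambda>\<omega>. S_partial A B t0 i N t \<omega> - S_series M A B t0 i t \<omega>)
          \<le> (D * q / (1 - q)) * q ^ N" for i N
  proof -
    have "norm_Linf M (\<lambda>\<omega>. (\<Sum>n\<le>N. ?F i n \<omega>) - S_series M A B t0 i t \<omega>)
            \<le> D * q ^ Suc N / (1 - q)"
      by (rule norm_Linf_geometric_tail[OF assms(1) F _ Linf_sums_AE_sums[OF assms(1) sums] bd])
        (use q sums[of i] in \<open>auto simp: Linf_sums_def rv_Linf_def\<close>)
    then show ?thesis by (simp add: S_partial_def mult_ac)
  qed
  with q sums show thesis by (rule that)
qed

section \<open>Dependence of the density on the fundamental solutions\<close>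

lemma lipschitz_affine_growth:
  fixes f :: "real \<Rightarrow> real"
  assumes "L-lipschitz_on UNIV f"
  shows "\<bar>f a\<bar> \<le> \<bar>f 0\<bar> + L * \<bar>a\<bar>"
  using lipschitz_onD[OF assms, of a 0] by (simp add: dist_real_def)

text \<open>The linear growth of \<open>f\<close> makes the bound affine in \<open>\<bar>y\<bar>\<close>, so the integrand of the
  density is integrable as soon as \<open>Y\<^sub>1\<close> has a mean.\<close>

lemma dens_integrand_bound:
  fixes f :: "real \<Rightarrow> real"
  assumes f: "L-lipschitz_on UNIV f" and u: "1/2 < u" and v: "\<bar>v\<bar> \<le> c"
  shows "\<bar>f ((x - y * v) / u) * (1 / \<bar>u\<bar>)\<bar> \<le> 2 * (\<bar>f 0\<bar> + 2 * L * (\<bar>x\<bar> + c * \<bar>y\<bar>))"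
proof -
  have L: "0 \<le> L" using f by (rule lipschitz_on_nonneg)
  have u2: "1 / u \<le> 2" using u by (simp add: field_simps)
  have num: "\<bar>x - y * v\<bar> \<le> \<bar>x\<bar> + c * \<bar>y\<bar>"
  proof -
    have "\<bar>y * v\<bar> \<le> c * \<bar>y\<bar>" using v by (simp add: abs_mult mult.commute mult_right_mono)
    then show ?thesis by linarith
  qed
  have "\<bar>(x - y * v) / u\<bar> = \<bar>x - y * v\<bar> * (1 / u)" using u by simp
  also have "\<dots> \<le> (\<bar>x\<bar> + c * \<bar>y\<bar>) * 2"
    using num u2 u by (intro mult_mono) auto
  finally have "L * \<bar>(x - y * v) / u\<bar> \<le> L * ((\<bar>x\<bar> + c * \<bar>y\<bar>) * 2)"
    using L by (rule mult_left_mono)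
  then have fa: "\<bar>f ((x - y * v) / u)\<bar> \<le> \<bar>f 0\<bar> + 2 * L * (\<bar>x\<bar> + c * \<bar>y\<bar>)"
    using lipschitz_affine_growth[OF f, of "(x - y * v) / u"] by (simp add: algebra_simps)
  have "\<bar>f ((x - y * v) / u) * (1 / \<bar>u\<bar>)\<bar> = \<bar>f ((x - y * v) / u)\<bar> * (1 / u)"
    using u by (simp add: abs_mult)
  also have "\<dots> \<le> (\<bar>f 0\<bar> + 2 * L * (\<bar>x\<bar> + c * \<bar>y\<bar>)) * 2"
    using fa u2 u by (intro mult_mono) auto
  finally show ?thesis by simp
qed

text \<open>With \<open>a = (x - y v) / u\<close> and \<open>a' = (x - y v') / u'\<close>, the estimate splits
  \<open>f a' / u' - f a / u = (f a' - f a) / u' + f a (1 / u' - 1 / u)\<close> and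
  \<open>a' - a = (x - y v) (1 / u' - 1 / u) - y (v' - v) / u'\<close>, so that only the bound on \<open>v\<close>, not one
  on \<open>v'\<close>, enters the constant; this is what makes the constant independent of \<open>N\<close>. The lower
  bounds on \<open>u\<close> and \<open>u'\<close> give \<open>\<bar>1 / u' - 1 / u\<bar> \<le> 8/3 \<bar>u' - u\<bar>\<close>; the
  constants \<open>9\<close> and \<open>3\<close> round up \<open>80/9\<close> and \<open>8/3\<close>.\<close>

lemma dens_integrand_diff:
  fixes f :: "real \<Rightarrow> real"
  assumes f: "L-lipschitz_on UNIV f" and u: "3/4 < u" and u': "1/2 < u'"
    and uu: "\<bar>u' - u\<bar> \<le> e0" and v: "\<bar>v\<bar> \<le> c" and vv: "\<bar>v' - v\<bar> \<le> e1"
  shows "\<bar>f ((x - y * v') / u') * (1 / \<bar>u'\<bar>) - f ((x - y * v) / u) * (1 / \<bar>u\<bar>)\<bar>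
         \<le> (9 * L + 3 * \<bar>f 0\<bar>) * (1 + \<bar>x\<bar> + c * \<bar>y\<bar>) * e0 + 4 * L * \<bar>y\<bar> * e1"
proof -
  define a where "a = (x - y * v) / u"
  define a' where "a' = (x - y * v') / u'"
  define P where "P = \<bar>x\<bar> + c * \<bar>y\<bar>"
  have L: "0 \<le> L" using f by (rule lipschitz_on_nonneg)
  have e: "0 \<le> e0" "0 \<le> e1" and c: "0 \<le> c" using uu vv v by auto
  have P0: "0 \<le> P" using c by (simp add: P_def)
  have num: "\<bar>x - y * v\<bar> \<le> P"
  proof -
    have "\<bar>y * v\<bar> \<le> c * \<bar>y\<bar>" using v by (simp add: abs_mult mult.commute mult_right_mono)
    then show ?thesis unfolding P_def by linarith
  qed
  have i': "1 / u' \<le> 2" using u' by (simp add: field_simps)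
  have i: "1 / u \<le> 4/3" using u by (simp add: field_simps)
  have inv: "\<bar>1 / u' - 1 / u\<bar> \<le> 8/3 * e0"
  proof -
    have "\<bar>1 / u' - 1 / u\<bar> = (1 / u') * (1 / u) * \<bar>u' - u\<bar>"
      using u u' by (simp add: diff_frac_eq abs_divide abs_mult abs_minus_commute)
    also have "\<dots> \<le> 2 * (4/3) * e0"
      using i i' u u' uu by (intro mult_mono) auto
    finally show ?thesis by simp
  qed
  have a_le: "\<bar>a\<bar> \<le> 4/3 * P"
  proof -
    have "\<bar>a\<bar> = (1 / u) * \<bar>x - y * v\<bar>" using u by (simp add: a_def)
    also have "\<dots> \<le> 4/3 * P" using i num u by (intro mult_mono) auto
    finally show ?thesis .
  qed
  have "a' - a = (x - y * v) * (1 / u' - 1 / u) - (1 / u') * (y * (v' - v))"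
    by (simp add: a_def a'_def diff_divide_distrib algebra_simps)
  then have "\<bar>a' - a\<bar> \<le> \<bar>x - y * v\<bar> * \<bar>1 / u' - 1 / u\<bar> + \<bar>1 / u'\<bar> * (\<bar>y\<bar> * \<bar>v' - v\<bar>)"
    unfolding abs_mult[symmetric] by (simp only: abs_triangle_ineq4)
  also have "\<dots> \<le> P * (8/3 * e0) + 2 * (\<bar>y\<bar> * e1)"
    using num inv i' u' vv P0 e by (intro add_mono mult_mono) auto
  finally have aa: "\<bar>a' - a\<bar> \<le> P * (8/3 * e0) + 2 * (\<bar>y\<bar> * e1)" .
  have "\<bar>f a' - f a\<bar> \<le> L * \<bar>a' - a\<bar>"
    using lipschitz_onD[OF f, of a' a] by (simp add: dist_real_def)
  also have "\<dots> \<le> L * (P * (8/3 * e0) + 2 * (\<bar>y\<bar> * e1))"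
    using aa L by (rule mult_left_mono)
  finally have ff: "\<bar>f a' - f a\<bar> \<le> L * (P * (8/3 * e0) + 2 * (\<bar>y\<bar> * e1))" .
  have "\<bar>f a\<bar> \<le> \<bar>f 0\<bar> + L * \<bar>a\<bar>" by (rule lipschitz_affine_growth[OF f])
  also have "\<dots> \<le> \<bar>f 0\<bar> + L * (4/3 * P)"
    using a_le L by (intro add_left_mono mult_left_mono)
  finally have fa: "\<bar>f a\<bar> \<le> \<bar>f 0\<bar> + L * (4/3 * P)" .
  have "f a' * (1 / u') - f a * (1 / u) = (f a' - f a) * (1 / u') + f a * (1 / u' - 1 / u)"
    by (simp add: algebra_simps)
  then have "\<bar>f a' * (1 / u') - f a * (1 / u)\<bar>
      \<le> \<bar>f a' - f a\<bar> * \<bar>1 / u'\<bar> + \<bar>f a\<bar> * \<bar>1 / u' - 1 / u\<bar>"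
    by (simp only: abs_mult[symmetric] abs_triangle_ineq)
  also have "\<dots> \<le> L * (P * (8/3 * e0) + 2 * (\<bar>y\<bar> * e1)) * 2
                  + (\<bar>f 0\<bar> + L * (4/3 * P)) * (8/3 * e0)"
    using ff i' u' fa inv P0 L e by (intro add_mono mult_mono) auto
  also have "\<dots> = 80/9 * (L * P * e0) + 8/3 * (\<bar>f 0\<bar> * e0) + 4 * L * \<bar>y\<bar> * e1"
    by (simp add: algebra_simps)
  also have "\<dots> \<le> (9 * L + 3 * \<bar>f 0\<bar>) * (1 + P) * e0 + 4 * L * \<bar>y\<bar> * e1"
  proof -
    have "0 \<le> L * P * e0" "0 \<le> \<bar>f 0\<bar> * e0" "0 \<le> L * e0" "0 \<le> \<bar>f 0\<bar> * P * e0"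
      using L P0 e by auto
    then show ?thesis by (simp add: algebra_simps)
  qed
  finally show ?thesis using u u' by (simp add: a_def a'_def P_def add.assoc)
qed

lemma integrable_dens_integrand:
  fixes f :: "real \<Rightarrow> real"
  assumes "prob_space M" and f: "L-lipschitz_on UNIV f" and Y: "integrable M Y"
    and [measurable]: "U \<in> borel_measurable M" "V \<in> borel_measurable M"
    and U: "AE \<omega> in M. 1/2 < U \<omega>" and V: "AE \<omega> in M. \<bar>V \<omega>\<bar> \<le> c"
  shows "integrable M (\<lambda>\<omega>. f ((x - Y \<omega> * V \<omega>) / U \<omega>) * (1 / \<bar>U \<omega>\<bar>))"
proof -
  interpret prob_space M by fact
  have [measurable]: "f \<in> borel_measurable borel"
    using lipschitz_on_continuous_on[OF f] by (rule borel_measurable_continuous_onI)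
  have [measurable]: "Y \<in> borel_measurable M" using Y by simp
  show ?thesis
  proof (rule Bochner_Integration.integrable_bound)
    show "integrable M (\<lambda>\<omega>. 2 * (\<bar>f 0\<bar> + 2 * L * (\<bar>x\<bar> + c * \<bar>Y \<omega>\<bar>)))"
      using Y by simp
    show "AE \<omega> in M. norm (f ((x - Y \<omega> * V \<omega>) / U \<omega>) * (1 / \<bar>U \<omega>\<bar>))
            \<le> norm (2 * (\<bar>f 0\<bar> + 2 * L * (\<bar>x\<bar> + c * \<bar>Y \<omega>\<bar>)))"
      using U V
    proof eventually_elim
      case (elim \<omega>)
      show ?case using dens_integrand_bound[OF f elim, of x "Y \<omega>"]
        unfolding real_norm_def by linarith
    qed
  qed measurable
qed

lemma dens_comb_diff:
  fixes f :: "real \<Rightarrow> real"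
  assumes "prob_space M" and f: "L-lipschitz_on UNIV f" and Y: "integrable M Y"
    and meas: "U \<in> borel_measurable M" "V \<in> borel_measurable M"
      "U' \<in> borel_measurable M" "V' \<in> borel_measurable M"
    and U: "AE \<omega> in M. 3/4 < U \<omega>" and U': "AE \<omega> in M. 1/2 < U' \<omega>"
    and UU: "AE \<omega> in M. \<bar>U' \<omega> - U \<omega>\<bar> \<le> e0"
    and V: "AE \<omega> in M. \<bar>V \<omega>\<bar> \<le> c" and VV: "AE \<omega> in M. \<bar>V' \<omega> - V \<omega>\<bar> \<le> e1"
  shows "\<bar>dens_comb M f Y U' V' x - dens_comb M f Y U V x\<bar>
         \<le> (9 * L + 3 * \<bar>f 0\<bar>) * (1 + \<bar>x\<bar> + c * (\<integral>\<omega>. \<bar>Y \<omega>\<bar> \<partial>M)) * e0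
           + 4 * L * (\<integral>\<omega>. \<bar>Y \<omega>\<bar> \<partial>M) * e1"
proof -
  interpret prob_space M by fact
  let ?g = "\<lambda>\<omega>. f ((x - Y \<omega> * V \<omega>) / U \<omega>) * (1 / \<bar>U \<omega>\<bar>)"
  let ?g' = "\<lambda>\<omega>. f ((x - Y \<omega> * V' \<omega>) / U' \<omega>) * (1 / \<bar>U' \<omega>\<bar>)"
  let ?h = "\<lambda>\<omega>. (9 * L + 3 * \<bar>f 0\<bar>) * (1 + \<bar>x\<bar> + c * \<bar>Y \<omega>\<bar>) * e0 + 4 * L * \<bar>Y \<omega>\<bar> * e1"
  have g: "integrable M ?g"
    by (rule integrable_dens_integrand[OF assms(1) f Y meas(1,2) _ V])
      (use U in \<open>auto elim: eventually_mono\<close>)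
  have V': "AE \<omega> in M. \<bar>V' \<omega>\<bar> \<le> c + e1"
    using V VV by eventually_elim linarith
  have g': "integrable M ?g'"
    by (rule integrable_dens_integrand[OF assms(1) f Y meas(3,4) U' V'])
  have h: "integrable M ?h" using Y by simp
  have "\<bar>dens_comb M f Y U' V' x - dens_comb M f Y U V x\<bar> = \<bar>\<integral>\<omega>. ?g' \<omega> - ?g \<omega> \<partial>M\<bar>"
    unfolding dens_comb_def using g g' by simp
  also have "\<dots> \<le> (\<integral>\<omega>. \<bar>?g' \<omega> - ?g \<omega>\<bar> \<partial>M)"
    by (rule integral_abs_bound)
  also have "\<dots> \<le> (\<integral>\<omega>. ?h \<omega> \<partial>M)"
  proof (rule integral_mono_AE)
    show "integrable M (\<lambda>\<omega>. \<bar>?g' \<omega> - ?g \<omega>\<bar>)"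
      using g g' by (intro integrable_abs Bochner_Integration.integrable_diff)
    show "AE \<omega> in M. \<bar>?g' \<omega> - ?g \<omega>\<bar> \<le> ?h \<omega>"
      using U U' UU V VV by eventually_elim (rule dens_integrand_diff[OF f])
  qed (rule h)
  also have "\<dots> = (9 * L + 3 * \<bar>f 0\<bar>) * (1 + \<bar>x\<bar> + c * (\<integral>\<omega>. \<bar>Y \<omega>\<bar> \<partial>M)) * e0
           + 4 * L * (\<integral>\<omega>. \<bar>Y \<omega>\<bar> \<partial>M) * e1"
    using Y by (simp add: prob_space)
  finally show ?thesis .
qed

lemma rv_L2_integrable_and_mean_le:
  assumes "prob_space M" and "rv_L2 M Y"
  shows "integrable M Y" and "(\<integral>\<omega>. \<bar>Y \<omega>\<bar> \<partial>M) \<le> norm_L2 M Y"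
proof -
  interpret prob_space M by fact
  have [measurable]: "Y \<in> borel_measurable M" and Y2: "integrable M (\<lambda>\<omega>. (Y \<omega>)\<^sup>2)"
    using assms(2) by (auto simp: rv_L2_def)
  show Y: "integrable M Y"
    using Y2 by (rule square_integrable_imp_integrable[rotated]) simp
  \<comment> \<open>Nonnegativity of the variance is the Cauchy-Schwarz inequality against \<open>1\<close>.\<close>
  have "0 \<le> variance (\<lambda>\<omega>. \<bar>Y \<omega>\<bar>)" by (rule variance_positive)
  also have "\<dots> = (\<integral>\<omega>. (Y \<omega>)\<^sup>2 \<partial>M) - (\<integral>\<omega>. \<bar>Y \<omega>\<bar> \<partial>M)\<^sup>2"
    using Y Y2 by (subst variance_eq) auto
  finally show "(\<integral>\<omega>. \<bar>Y \<omega>\<bar> \<partial>M) \<le> norm_L2 M Y"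
    unfolding norm_L2_def by (intro real_le_rsqrt) simp
qed

section \<open>Approximation of the density\<close>

theorem mainTheorem6:
  fixes M :: "'a measure"
    and t0 r \<delta> :: real
    and A B :: "nat \<Rightarrow> 'a \<Rightarrow> real"
    and Y0 Y1 :: "'a \<Rightarrow> real"
    and f :: "real \<Rightarrow> real"
    and Nt :: "real \<Rightarrow> nat"
  assumes "prob_space M" and "complete_measure M"
    and "0 < r"
    and "Linf_power_series M A t0 r" and "Linf_power_series M B t0 r"
    and "rv_L2 M Y0" and "rv_L2 M Y1"
    and "\<forall>x. 0 \<le> f x" and "distributed M lborel Y0 (\<lambda>x. ennreal (f x))"
    and "indep_rv M borel Y0
           ((borel :: real measure) \<Otimes>\<^sub>M (PiM UNIV (\<lambda>_::nat. borel)) \<Otimes>\<^sub>M (PiM UNIV (\<lambda>_::nat. borel)))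
           (\<lambda>\<omega>. (Y1 \<omega>, (\<lambda>n. A n \<omega>), (\<lambda>n. B n \<omega>)))"
    and "\<exists>L. lipschitz_on L UNIV f"
    and "0 < \<delta>" and "\<delta> \<le> r"
    and "\<forall>t\<in>{t0-\<delta><..<t0+\<delta>}. norm_Linf M (\<lambda>\<omega>. S_series M A B t0 0 t \<omega> - 1) < 1/4"
    and "\<forall>t\<in>{t0-\<delta><..<t0+\<delta>}. 0 < Nt t \<and>
           (\<forall>N\<ge>Nt t. norm_Linf M (\<lambda>\<omega>. S_partial A B t0 0 N t \<omega> - S_series M A B t0 0 t \<omega>) < 1/4)"
  shows "\<forall>t\<in>{t0-\<delta><..<t0+\<delta>}.
     (\<exists>C>0. \<forall>x. \<forall>N\<ge>Nt t.
        \<bar>dens_XN M f Y1 A B t0 N t x - dens_X M f Y1 A B t0 t x\<bar>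
        \<le> C * ((\<bar>x\<bar> + 1) * norm_Linf M (\<lambda>\<omega>. S_partial A B t0 0 N t \<omega> - S_series M A B t0 0 t \<omega>)
               + norm_L2 M Y1 * norm_Linf M (\<lambda>\<omega>. S_partial A B t0 1 N t \<omega> - S_series M A B t0 1 t \<omega>)))
     \<and> (\<forall>x. \<exists>K>0. \<exists>q. 0 < q \<and> q < 1 \<and>
          (\<forall>N\<ge>Nt t. \<bar>dens_XN M f Y1 A B t0 N t x - dens_X M f Y1 A B t0 t x\<bar> \<le> K * q ^ N))"
proof
  fix t assume t: "t \<in> {t0-\<delta><..<t0+\<delta>}"
  let ?U = "S_series M A B t0 0 t" and ?V = "S_series M A B t0 1 t"
  let ?UN = "\<lambda>N. S_partial A B t0 0 N t" and ?VN = "\<lambda>N. S_partial A B t0 1 N t"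
  let ?e0 = "\<lambda>N. norm_Linf M (\<lambda>\<omega>. ?UN N \<omega> - ?U \<omega>)"
  let ?e1 = "\<lambda>N. norm_Linf M (\<lambda>\<omega>. ?VN N \<omega> - ?V \<omega>)"
  let ?err = "\<lambda>x N. \<bar>dens_XN M f Y1 A B t0 N t x - dens_X M f Y1 A B t0 t x\<bar>"
  note P = \<open>prob_space M\<close>
  interpret prob_space M by fact
  have "\<bar>t - t0\<bar> < r" using t \<open>\<delta> \<le> r\<close> by auto
  then obtain q D where q: "0 < q" "q < 1"
    and sums: "\<And>i. Linf_sums M (\<lambda>n \<omega>. S_coeff A B i n \<omega> * (t - t0) ^ n) (S_series M A B t0 i t)"
    and rate: "\<And>i N. norm_Linf M (\<lambda>\<omega>. S_partial A B t0 i N t \<omega> - S_series M A B t0 i t \<omega>) \<le> D * q ^ N"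
    by (rule S_series_Linf[OF P \<open>Linf_power_series M A t0 r\<close> \<open>Linf_power_series M B t0 r\<close>])
      (rule that)
  have S_Linf: "rv_Linf M (S_series M A B t0 i t)" for i
    using sums[of i] by (simp add: Linf_sums_def)
  have SN_Linf: "rv_Linf M (S_partial A B t0 i N t)" for i N
  proof -
    have "rv_Linf M (\<lambda>\<omega>. \<Sum>n\<le>N. S_coeff A B i n \<omega> * (t - t0) ^ n)"
      by (rule rv_Linf_sum[OF P]) (use sums[of i] in \<open>simp add: Linf_sums_def\<close>)
    then show ?thesis by (simp add: S_partial_def[abs_def])
  qed
  note diff_Linf = rv_Linf_diff[OF P SN_Linf S_Linf]
  have meas: "S_series M A B t0 i t \<in> borel_measurable M"
    "S_partial A B t0 i N t \<in> borel_measurable M" for i N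
    using S_Linf SN_Linf by (auto simp: rv_Linf_def)
  have "rv_Linf M (\<lambda>_. 1 :: real)"
    by (rule rv_Linf_norm_Linf_le(1)[OF P, of _ 1]) auto
  then have "AE \<omega> in M. \<bar>?U \<omega> - 1\<bar> \<le> norm_Linf M (\<lambda>\<omega>. ?U \<omega> - 1)"
    by (intro AE_abs_le_norm_Linf rv_Linf_diff P S_Linf)
  moreover have "norm_Linf M (\<lambda>\<omega>. ?U \<omega> - 1) < 1/4" using assms(14) t by blast
  ultimately have U: "AE \<omega> in M. 3/4 < ?U \<omega>"
    by (auto elim!: eventually_mono)
  have Nt: "?e0 N < 1/4" if "N \<ge> Nt t" for N using assms(15) t that by blast
  have AE_diff: "AE \<omega> in M. \<bar>S_partial A B t0 i N t \<omega> - S_series M A B t0 i t \<omega>\<bar>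
      \<le> norm_Linf M (\<lambda>\<omega>. S_partial A B t0 i N t \<omega> - S_series M A B t0 i t \<omega>)" for i N
    by (rule AE_abs_le_norm_Linf[OF P diff_Linf])
  obtain L where L: "L-lipschitz_on UNIV f" using assms(11) by blast
  have L0: "0 \<le> L" using L by (rule lipschitz_on_nonneg)
  define c where "c = norm_Linf M ?V"
  define m where "m = (\<integral>\<omega>. \<bar>Y1 \<omega>\<bar> \<partial>M)"
  define k where "k = 9 * L + 3 * \<bar>f 0\<bar>"
  \<comment> \<open>The first summand dominates the coefficient of the error of \<open>S\<^sub>0\<close>, because
    \<open>1 + \<bar>x\<bar> + c m \<le> (1 + c m) (1 + \<bar>x\<bar>)\<close>, the second that of the error of \<open>S\<^sub>1\<close>; the last makes
    \<open>C\<close> positive.\<close>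
  define C where "C = k * (1 + c * m) + 4 * L + 1"
  note Y1 = rv_L2_integrable_and_mean_le[OF P \<open>rv_L2 M Y1\<close>]
  have nonneg: "0 \<le> c" "0 \<le> m" "0 \<le> k" "0 \<le> ?e0 N" "0 \<le> ?e1 N" for N
    using norm_Linf_nonneg[OF P] S_Linf diff_Linf L0 by (auto simp: c_def m_def k_def)
  have mY: "m \<le> norm_L2 M Y1" using Y1(2) by (simp add: m_def)
  have C: "0 < C" using nonneg L0 by (simp add: C_def add_nonneg_pos)
  have main: "?err x N \<le> C * ((\<bar>x\<bar> + 1) * ?e0 N + norm_L2 M Y1 * ?e1 N)"
    if N: "N \<ge> Nt t" for x N
  proof -
    have "AE \<omega> in M. \<bar>?UN N \<omega> - ?U \<omega>\<bar> \<le> ?e0 N" by (rule AE_diff)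
    with U have UN: "AE \<omega> in M. 1/2 < ?UN N \<omega>"
      by eventually_elim (use Nt[OF N] in linarith)
    have "?err x N \<le> k * (1 + \<bar>x\<bar> + c * m) * ?e0 N + 4 * L * m * ?e1 N"
      unfolding dens_XN_def dens_X_def k_def m_def
      by (rule dens_comb_diff[OF P L Y1(1) meas(1) meas(1) meas(2) meas(2) U UN AE_diff _ AE_diff])
        (unfold c_def, rule AE_abs_le_norm_Linf[OF P S_Linf])
    also have "k * (1 + \<bar>x\<bar> + c * m) \<le> C * (\<bar>x\<bar> + 1)"
    proof -
      have "k * (1 + \<bar>x\<bar> + c * m) \<le> k * ((1 + c * m) * (\<bar>x\<bar> + 1))"
        using nonneg by (intro mult_left_mono) (auto simp: algebra_simps)
      also have "\<dots> \<le> C * (\<bar>x\<bar> + 1)"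
        unfolding C_def mult.assoc[symmetric] using L0 by (intro mult_right_mono) auto
      finally show ?thesis .
    qed
    also have "4 * L * m \<le> C * norm_L2 M Y1"
      using mY nonneg L0 by (intro mult_mono) (auto simp: C_def)
    finally show ?thesis using nonneg
      by (auto simp: algebra_simps mult_right_mono)
  qed
  have "\<exists>K>0. \<exists>q. 0 < q \<and> q < 1 \<and> (\<forall>N\<ge>Nt t. ?err x N \<le> K * q ^ N)" for x
  proof -
    define G where "G = C * ((\<bar>x\<bar> + 1) * D + norm_L2 M Y1 * D)"
    have G: "?err x N \<le> G * q ^ N" if "N \<ge> Nt t" for N
    proof -
      have "?err x N \<le> C * ((\<bar>x\<bar> + 1) * ?e0 N + norm_L2 M Y1 * ?e1 N)"
        by (rule main[OF that])
      also have "\<dots> \<le> C * ((\<bar>x\<bar> + 1) * (D * q ^ N) + norm_L2 M Y1 * (D * q ^ N))"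
        using C mY nonneg(2) by (intro mult_left_mono add_mono rate) auto
      also have "\<dots> = G * q ^ N" by (simp add: G_def algebra_simps)
      finally show ?thesis .
    qed
    have "?err x N \<le> (\<bar>G\<bar> + 1) * q ^ N" if "N \<ge> Nt t" for N
    proof -
      have "G * q ^ N \<le> (\<bar>G\<bar> + 1) * q ^ N" using q by (intro mult_right_mono) auto
      with G[OF that] show ?thesis by linarith
    qed
    then show ?thesis using q by (intro exI[of _ "\<bar>G\<bar> + 1"] conjI exI[of _ q]) auto
  qed
  with main C show "(\<exists>C>0. \<forall>x. \<forall>N\<ge>Nt t. ?err x N \<le> C * ((\<bar>x\<bar> + 1) * ?e0 N + norm_L2 M Y1 * ?e1 N))
     \<and> (\<forall>x. \<exists>K>0. \<exists>q. 0 < q \<and> q < 1 \<and> (\<forall>N\<ge>Nt t. ?err x N \<le> K * q ^ N))"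
    by blast
qed

end
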